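(* Let $D$ be a skew field, $\sigma$ a ring automorphism of $D$, $\delta$ a $\sigma$-derivation of $D$. Assume that $R=D[X;\sigma,\delta]$ is generated, as an algebra over its center, by a finite set $\{d_1,\dots,d_s\}$. Let $f\in R$ be a nonzero polynomial. (a) $Rf=Rf^*$ if and only if $\operatorname{lrem}(f d_i,f)=0$ for all $1\le i\le s$. (b) If $\operatorname{lrem}(f d_{i_0},f)\neq 0$ for some $1\le i_0\le s$, then $Rf^*=R\,([f_{d_{i_0}},f]_\ell)^*$, where $f_{d_{i_0}}\in R$ is such that $Rf_{d_{i_0}}=\operatorname{Ann}_R(d_{i_0}+Rf)$, and moreover $R[f_{d_{i_0}},f]_\ell\subsetneq Rf$.
   Context: A $\sigma$-derivation is an additive map $\delta:D\to D$ with $\delta(ab)=\sigma(a)\delta(b)+\delta(a)b$. $R=D[X;\sigma,\delta]$ is the Ore polynomial ring: a left $D$-vector space with basis $\{X^n: n\ge 0\}$, with $Xa=\sigma(a)X+\delta(a)$ for $a\in D$. It is a left and right principal ideal domain. For $g\neq 0$, $\operatorname{lrem}(h,g)$ denotes the unique $\rho\in R$ with $\deg\rho<\deg g$ and $h=qg+\rho$ for some $q\in R$ (so $\operatorname{lrem}(h,g)=0$ iff $h\in Rg$). $\operatorname{Ann}_R(d+Rf)=\{g\in R: gd\in Rf\}$ is the annihilator of the element $d+Rf$ of $R/Rf$. A polynomial $\alpha$ is twosided if $R\alpha=\alpha R$. A bound of $f\in R$ is a twosided polynomial $f^*$ such that $Rf^*=f^*R$ is the largest twosided ideal contained in $Rf$;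 equivalently $Rf^*=\operatorname{Ann}_R(R/Rf)$. It is determined up to left multiplication by nonzero elements of $D$ (and may be $0$). The left least common multiple $[g,h]_\ell$ is a generator of $Rg\cap Rh$. *)

theory Defs
  imports "HOL-Algebra.Generated_Rings" "HOL-Computational_Algebra.Polynomial"
begin

hide_const (open) UnivPoly.coeff UnivPoly.monom

section \<open>Ore polynomial rings\<close>

definition ring_automorphism :: "('a::ring_1 \<Rightarrow> 'a) \<Rightarrow> bool" where
  "ring_automorphism \<sigma> \<longleftrightarrow>
     bij \<sigma> \<and> (\<forall>a b. \<sigma> (a + b) = \<sigma> a + \<sigma> b) \<and> (\<forall>a b. \<sigma> (a * b) = \<sigma> a * \<sigma> b) \<and> \<sigma> 1 = 1"

definition skew_derivation :: "('a::ring_1 \<Rightarrow> 'a) \<Rightarrow> ('a \<Rightarrow> 'a) \<Rightarrow> bool" where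
  "skew_derivation \<sigma> \<delta> \<longleftrightarrow>
     (\<forall>a b. \<delta> (a + b) = \<delta> a + \<delta> b) \<and> (\<forall>a b. \<delta> (a * b) = \<sigma> a * \<delta> b + \<delta> a * b)"

text \<open>
  An element of \<open>D[X;\<sigma>,\<delta>]\<close> is represented by its coefficient sequence, with the coefficients
  written on the left of the powers of \<open>X\<close>; only the additive structure of \<^typ>\<open>'a poly\<close>
  is used, since its library product needs commutative coefficients.
  The rule \<open>X b = \<sigma>(b) X + \<delta>(b)\<close> gives
  \<open>X (\<Sum>j. b\<^sub>j X^j) = (\<Sum>j. \<sigma>(b\<^sub>j) X^(j+1)) + (\<Sum>j. \<delta>(b\<^sub>j) X^j)\<close>, and then
  \<open>(\<Sum>i. a\<^sub>i X^i) q = (\<Sum>i. a\<^sub>i (X^i q))\<close>.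
\<close>

definition ore_scale :: "'a::division_ring \<Rightarrow> 'a poly \<Rightarrow> 'a poly" where
  "ore_scale a q = map_poly (\<lambda>c. a * c) q"

definition ore_X_times :: "('a::division_ring \<Rightarrow> 'a) \<Rightarrow> ('a \<Rightarrow> 'a) \<Rightarrow> 'a poly \<Rightarrow> 'a poly" where
  "ore_X_times \<sigma> \<delta> q = pCons 0 (map_poly \<sigma> q) + map_poly \<delta> q"

definition ore_times ::
    "('a::division_ring \<Rightarrow> 'a) \<Rightarrow> ('a \<Rightarrow> 'a) \<Rightarrow> 'a poly \<Rightarrow> 'a poly \<Rightarrow> 'a poly" where
  "ore_times \<sigma> \<delta> p q = (\<Sum>i\<le>degree p. ore_scale (coeff p i) ((ore_X_times \<sigma> \<delta> ^^ i) q))"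

definition ore_ring :: "('a::division_ring \<Rightarrow> 'a) \<Rightarrow> ('a \<Rightarrow> 'a) \<Rightarrow> 'a poly ring" where
  "ore_ring \<sigma> \<delta> =
     \<lparr>carrier = UNIV, monoid.mult = ore_times \<sigma> \<delta>, one = [:1:], zero = 0, add = (+)\<rparr>"

text \<open>
  Since \<^term>\<open>degree 0 = 0\<close> in the library, the convention that the zero polynomial has degree
  \<open>-\<infinity>\<close> is spelled out as a separate case.
\<close>

definition lrem ::
    "('a::division_ring \<Rightarrow> 'a) \<Rightarrow> ('a \<Rightarrow> 'a) \<Rightarrow> 'a poly \<Rightarrow> 'a poly \<Rightarrow> 'a poly" where
  "lrem \<sigma> \<delta> h g =
     (THE \<rho>. (\<rho> = 0 \<or> degree \<rho> < degree g) \<and>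
             (\<exists>q \<in> carrier (ore_ring \<sigma> \<delta>). h = q \<otimes>\<^bsub>ore_ring \<sigma> \<delta>\<^esub> g \<oplus>\<^bsub>ore_ring \<sigma> \<delta>\<^esub> \<rho>))"


section \<open>Notions for noncommutative rings\<close>

text \<open>
  The library set \<open>PIdl\<^bsub>R\<^esub> a\<close> is the left ideal \<open>R a\<close>, and the library locale
  \<^locale>\<open>ideal\<close> describes twosided ideals.
\<close>

definition right_principal :: "('r, 'm) ring_scheme \<Rightarrow> 'r \<Rightarrow> 'r set" where
  "right_principal R a = {a \<otimes>\<^bsub>R\<^esub> x | x. x \<in> carrier R}"

definition ring_center :: "('r, 'm) ring_scheme \<Rightarrow> 'r set" where
  "ring_center R = {z \<in> carrier R. \<forall>x \<in> carrier R. z \<otimes>\<^bsub>R\<^esub> x = x \<otimes>\<^bsub>R\<^esub> z}"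

text \<open>The subalgebra over the center generated by \<open>S\<close>: a subring is closed under multiplication
  by central elements iff it contains the center.\<close>

definition center_subalgebra :: "('r, 'm) ring_scheme \<Rightarrow> 'r set \<Rightarrow> 'r set" where
  "center_subalgebra R S = generate_ring R (ring_center R \<union> S)"

text \<open>The annihilator of the element \<open>d + R f\<close> of the left module \<open>R / R f\<close>.\<close>

definition left_ann :: "('r, 'm) ring_scheme \<Rightarrow> 'r \<Rightarrow> 'r \<Rightarrow> 'r set" where
  "left_ann R d f = {g \<in> carrier R. g \<otimes>\<^bsub>R\<^esub> d \<in> PIdl\<^bsub>R\<^esub> f}"

definition twosided :: "('r, 'm) ring_scheme \<Rightarrow> 'r \<Rightarrow> bool" where
  "twosided R a \<longleftrightarrow> a \<in> carrier R \<and> PIdl\<^bsub>R\<^esub> a = right_principal R a"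

definition is_bound :: "('r, 'm) ring_scheme \<Rightarrow> 'r \<Rightarrow> 'r \<Rightarrow> bool" where
  "is_bound R b f \<longleftrightarrow>
     twosided R b \<and> ideal (PIdl\<^bsub>R\<^esub> b) R \<and> PIdl\<^bsub>R\<^esub> b \<subseteq> PIdl\<^bsub>R\<^esub> f \<and>
     (\<forall>I. ideal I R \<and> I \<subseteq> PIdl\<^bsub>R\<^esub> f \<longrightarrow> I \<subseteq> PIdl\<^bsub>R\<^esub> b)"

definition is_llcm :: "('r, 'm) ring_scheme \<Rightarrow> 'r \<Rightarrow> 'r \<Rightarrow> 'r \<Rightarrow> bool" where
  "is_llcm R m g h \<longleftrightarrow> m \<in> carrier R \<and> PIdl\<^bsub>R\<^esub> m = PIdl\<^bsub>R\<^esub> g \<inter> PIdl\<^bsub>R\<^esub> h"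


section \<open>Well-definedness of these notions\<close>

locale ore_extension =
  fixes \<sigma> \<delta> :: "'a::division_ring \<Rightarrow> 'a"
  assumes aut: "ring_automorphism \<sigma>" and der: "skew_derivation \<sigma> \<delta>"
begin

abbreviation "L \<equiv> ore_scale"
abbreviation "X \<equiv> ore_X_times \<sigma> \<delta>"
abbreviation ot (infixl "\<cdot>" 70) where "p \<cdot> q \<equiv> ore_times \<sigma> \<delta> p q"
abbreviation "R \<equiv> ore_ring \<sigma> \<delta>"

lemma sigma_simps: "\<sigma> (a + b) = \<sigma> a + \<sigma> b" "\<sigma> (a * b) = \<sigma> a * \<sigma> b" "\<sigma> 1 = 1"
  using aut by (auto simp: ring_automorphism_def)

lemma delta_simps: "\<delta> (a + b) = \<delta> a + \<delta> b" "\<delta> (a * b) = \<sigma> a * \<delta> b + \<delta> a * b"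
  using der by (auto simp: skew_derivation_def)

lemma sigma_0 [simp]: "\<sigma> 0 = 0"
  using sigma_simps(1)[of 0 0] by simp

lemma delta_0 [simp]: "\<delta> 0 = 0"
  using delta_simps(1)[of 0 0] by simp

lemma delta_1 [simp]: "\<delta> 1 = 0"
  using delta_simps(2)[of 1 1] by (simp add: sigma_simps)

lemma sigma_eq_0_iff [simp]: "\<sigma> a = 0 \<longleftrightarrow> a = 0"
  using aut by (metis bij_pointE ring_automorphism_def sigma_0)

lemma coeff_L [simp]: "coeff (L a q) n = a * coeff q n"
  by (simp add: ore_scale_def coeff_map_poly)

lemma coeff_X: "coeff (X q) n = (case n of 0 \<Rightarrow> 0 | Suc k \<Rightarrow> \<sigma> (coeff q k)) + \<delta> (coeff q n)"
  by (simp add: ore_X_times_def coeff_map_poly coeff_pCons split: nat.splits)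

lemma L_add: "L a (p + q) = L a p + L a q"
  by (rule poly_eqI) (simp add: algebra_simps)
lemma L_add_left: "L (a + b) p = L a p + L b p"
  by (rule poly_eqI) (simp add: algebra_simps)
lemma L_L: "L a (L b p) = L (a * b) p"
  by (rule poly_eqI) (simp add: mult.assoc)
lemma L_0 [simp]: "L a 0 = 0" "L 0 p = 0"
  by (auto intro: poly_eqI)
lemma L_1 [simp]: "L 1 p = p"
  by (auto intro: poly_eqI)

lemma X_add: "X (p + q) = X p + X q"
  by (rule poly_eqI) (simp add: coeff_X sigma_simps delta_simps algebra_simps split: nat.splits)
lemma X_0 [simp]: "X 0 = 0"
  by (rule poly_eqI) (simp add: coeff_X split: nat.splits)
lemma X_L: "X (L a p) = L (\<sigma> a) (X p) + L (\<delta> a) p"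
  by (rule poly_eqI) (simp add: coeff_X sigma_simps delta_simps algebra_simps split: nat.splits)
lemma X_monom: "X (monom a n) = monom (\<sigma> a) (Suc n) + monom (\<delta> a) n"
  by (rule poly_eqI) (auto simp: coeff_X split: nat.splits)

lemma Xn_add: "(X ^^ n) (p + q) = (X ^^ n) p + (X ^^ n) q"
  by (induction n) (simp_all add: X_add)
lemma Xn_0 [simp]: "(X ^^ n) 0 = 0"
  by (induction n) simp_all

lemma ot_extend: "degree p \<le> n \<Longrightarrow> p \<cdot> q = (\<Sum>i\<le>n. L (coeff p i) ((X ^^ i) q))"
  unfolding ore_times_def by (rule sum.mono_neutral_left) (auto simp: coeff_eq_0)

lemma ot_add_left: "(p + p') \<cdot> q = p \<cdot> q + p' \<cdot> q"
proof -
  define n where "n = max (degree p) (degree p')"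
  have "degree (p + p') \<le> n" "degree p \<le> n" "degree p' \<le> n"
    by (auto simp: n_def degree_add_le_max)
  then show ?thesis
    by (simp add: ot_extend[of _ n] L_add_left sum.distrib)
qed

lemma ot_add_right: "p \<cdot> (q + q') = p \<cdot> q + p \<cdot> q'"
  by (simp add: ore_times_def Xn_add L_add sum.distrib)

lemma ot_0 [simp]: "p \<cdot> 0 = 0" "0 \<cdot> p = 0"
  by (simp_all add: ore_times_def)

lemma ot_minus_left: "(- p) \<cdot> q = - (p \<cdot> q)"
  using ot_add_left[of "- p" p q] by (simp add: eq_neg_iff_add_eq_0)

lemma ot_minus_right: "p \<cdot> (- q) = - (p \<cdot> q)"
  using ot_add_right[of p "- q" q] by (simp add: eq_neg_iff_add_eq_0)

lemma ot_diff_left: "(p - p') \<cdot> q = p \<cdot> q - p' \<cdot> q"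
  using ot_add_left[of p "- p'" q] by (simp add: ot_minus_left)

lemma ot_sum_left: "(\<Sum>i\<in>A. p i) \<cdot> q = (\<Sum>i\<in>A. p i \<cdot> q)"
  by (induction A rule: infinite_finite_induct) (auto simp: ot_add_left)

lemma ot_monom: "monom a n \<cdot> q = L a ((X ^^ n) q)"
proof -
  have "monom a n \<cdot> q = (\<Sum>i\<le>n. L (if n = i then a else 0) ((X ^^ i) q))"
    by (subst ot_extend[of _ n]) (auto simp: degree_monom_le)
  also have "\<dots> = (\<Sum>i\<le>n. if i = n then L a ((X ^^ n) q) else 0)"
    by (rule sum.cong) auto
  finally show ?thesis by simp
qed

lemma poly_as_monoms: "p = (\<Sum>i\<le>degree p. monom (coeff p i) i)" for p :: "'a poly"
  by (simp add: poly_as_sum_of_monoms)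

lemma sum_monom_induct:
  assumes "\<And>a n. P (monom a n)" "\<And>p q. P p \<Longrightarrow> P q \<Longrightarrow> P (p + q)" "P 0"
  shows "P (p :: 'a poly)"
proof -
  have "P (\<Sum>i\<in>A. monom (coeff p i) i)" for A
    by (induction A rule: infinite_finite_induct) (auto simp: assms)
  then show ?thesis by (metis poly_as_monoms)
qed

lemma L_ot: "L a p \<cdot> q = L a (p \<cdot> q)"
proof -
  have "degree (L a p) \<le> degree p"
    by (rule degree_le) (auto simp: coeff_eq_0)
  then have "L a p \<cdot> q = (\<Sum>i\<le>degree p. L a (L (coeff p i) ((X ^^ i) q)))"
    by (simp add: ot_extend L_L)
  also have "\<dots> = L a (p \<cdot> q)"
    unfolding ore_times_def
    by (rule sum_comp_morphism[unfolded o_def, symmetric, of "L a", symmetric]) (auto simp: L_add)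
  finally show ?thesis .
qed

lemma X_ot: "X p \<cdot> q = X (p \<cdot> q)"
  by (induction p rule: sum_monom_induct)
     (simp_all add: X_monom ot_add_left ot_monom X_L X_add)

lemma Xn_ot: "(X ^^ n) p \<cdot> q = (X ^^ n) (p \<cdot> q)"
  by (induction n) (simp_all add: X_ot)

lemma ot_assoc: "(p \<cdot> q) \<cdot> r = p \<cdot> (q \<cdot> r)"
  unfolding ore_times_def[of _ _ p] by (simp add: ot_sum_left L_ot Xn_ot)

lemma one_ot: "[:1:] \<cdot> q = q"
  by (simp add: ore_times_def)

lemma ot_one: "p \<cdot> [:1:] = p"
proof -
  have 1: "(X ^^ n) [:1:] = monom 1 n" for n
    by (induction n) (simp_all add: X_monom sigma_simps monom_0)
  have 2: "L a (monom 1 n) = monom a n" for a n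
    by (rule poly_eqI) simp
  show ?thesis
    by (simp add: ore_times_def 1 2 poly_as_monoms[symmetric])
qed

lemma ore_ring_simps [simp]:
  "carrier R = UNIV" "p \<otimes>\<^bsub>R\<^esub> q = p \<cdot> q" "\<one>\<^bsub>R\<^esub> = [:1:]" "\<zero>\<^bsub>R\<^esub> = 0" "p \<oplus>\<^bsub>R\<^esub> q = p + q"
  by (simp_all add: ore_ring_def)

theorem ring_ore_ring: "ring R"
proof (rule ringI)
  show "abelian_group R"
    by (rule abelian_groupI) (auto simp: add_ac intro: exI[of _ "- _"])
  show "monoid R"
    by (rule monoidI) (auto simp: ot_assoc one_ot ot_one)
qed (auto simp: ot_add_left ot_add_right)

text \<open>The defining relation.\<close>

lemma X_commute: "monom 1 1 \<cdot> [:a:] = monom (\<sigma> a) 1 + [:\<delta> a:]"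
  by (simp add: ot_monom X_monom flip: monom_0)


subsection \<open>Degrees and division\<close>

lemma Xn_above: "k > degree p + n \<Longrightarrow> coeff ((X ^^ n) p) k = 0"
  by (induction n arbitrary: k) (auto simp: coeff_X coeff_eq_0 split: nat.splits)

lemma Xn_top: "coeff ((X ^^ n) p) (degree p + n) = (\<sigma> ^^ n) (lead_coeff p)"
  by (induction n) (auto simp: coeff_X Xn_above)

lemma sigma_pow_eq_0_iff [simp]: "(\<sigma> ^^ n) a = 0 \<longleftrightarrow> a = 0"
  by (induction n) auto

lemma ot_above: "k > degree p + degree q \<Longrightarrow> coeff (p \<cdot> q) k = 0"
  unfolding ore_times_def by (auto simp: coeff_sum Xn_above intro!: sum.neutral)

lemma ot_top: "coeff (p \<cdot> q) (degree p + degree q) =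
    lead_coeff p * (\<sigma> ^^ degree p) (lead_coeff q)"
proof -
  have "coeff (p \<cdot> q) (degree p + degree q) =
      (\<Sum>i\<le>degree p. coeff p i * coeff ((X ^^ i) q) (degree p + degree q))"
    by (simp add: ore_times_def coeff_sum)
  also have "\<dots> = (\<Sum>i\<in>{degree p}. coeff p i * coeff ((X ^^ i) q) (degree p + degree q))"
    by (rule sum.mono_neutral_right) (auto simp: Xn_above)
  finally show ?thesis
    using Xn_top[of "degree p" q] by (simp add: add.commute[of "degree p"])
qed

lemma degree_ot: "p \<noteq> 0 \<Longrightarrow> q \<noteq> 0 \<Longrightarrow> degree (p \<cdot> q) = degree p + degree q"
  by (intro antisym degree_le le_degree) (auto simp: ot_above ot_top)

lemma ot_eq_0_iff [simp]: "p \<cdot> q = 0 \<longleftrightarrow> p = 0 \<or> q = 0"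
  using ot_top[of p q] by fastforce

lemma degree_diff_less_top:
  fixes h p :: "'a poly"
  assumes "degree h = n" "degree p = n" "lead_coeff p = lead_coeff h"
  shows "h - p = 0 \<or> degree (h - p) < n"
proof -
  have "degree (h - p) \<le> n" "coeff (h - p) n = 0"
    using assms degree_diff_le[of h n p] by auto
  then show ?thesis
    by (metis leading_coeff_0_iff le_neq_implies_less)
qed

lemma left_division:
  assumes "g \<noteq> 0"
  shows "\<exists>q r. h = q \<cdot> g + r \<and> (r = 0 \<or> degree r < degree g)"
proof (induction "if h = 0 then 0 else Suc (degree h)" arbitrary: h rule: less_induct)
  case less
  show ?case
  proof (cases "h = 0 \<or> degree h < degree g")
    case True
    then show ?thesis by (intro exI[of _ 0] exI[of _ h]) auto
  next
    case False
    define k where "k = degree h - degree g"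
    define c where "c = lead_coeff h * inverse ((\<sigma> ^^ k) (lead_coeff g))"
    define p where "p = monom c k \<cdot> g"
    have c: "c \<noteq> 0" using False assms by (simp add: c_def)
    then have m: "monom c k \<noteq> 0" "degree (monom c k) = k" by (auto simp: degree_monom_eq)
    have dp: "degree p = degree h"
      unfolding p_def using degree_ot[OF m(1) assms] m(2) False by (simp add: k_def)
    have "coeff p (degree h) = c * (\<sigma> ^^ k) (lead_coeff g)"
      using ot_top[of "monom c k" g] m(2) False by (simp add: p_def k_def)
    then have "lead_coeff p = lead_coeff h"
      using assms dp by (simp add: c_def mult.assoc)
    then have "h - p = 0 \<or> degree (h - p) < degree h"
      using degree_diff_less_top[OF refl dp] by simp
    then have "\<exists>q r. h - p = q \<cdot> g + r \<and> (r = 0 \<or> degree r < degree g)"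
      by (intro less.hyps) (use False in auto)
    then obtain q r where "h - p = q \<cdot> g + r" "r = 0 \<or> degree r < degree g"
      by blast
    then show ?thesis
      by (intro exI[of _ "q + monom c k"] exI[of _ r]) (auto simp: ot_add_left p_def algebra_simps)
  qed
qed

lemma right_division:
  assumes "g \<noteq> 0"
  shows "\<exists>q r. h = g \<cdot> q + r \<and> (r = 0 \<or> degree r < degree g)"
proof (induction "if h = 0 then 0 else Suc (degree h)" arbitrary: h rule: less_induct)
  case less
  show ?case
  proof (cases "h = 0 \<or> degree h < degree g")
    case True
    then show ?thesis by (intro exI[of _ 0] exI[of _ h]) auto
  next
    case False
    define k where "k = degree h - degree g"
    have "surj \<sigma>" using aut by (simp add: ring_automorphism_def bij_is_surj)
    then have "surj (\<sigma> ^^ degree g)" by (rule surj_fn)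
    then obtain c where c: "(\<sigma> ^^ degree g) c = inverse (lead_coeff g) * lead_coeff h"
      by (metis surjD)
    then have "(\<sigma> ^^ degree g) c \<noteq> 0" using False assms by simp
    then have "c \<noteq> 0" by simp
    define p where "p = g \<cdot> monom c k"
    have m: "monom c k \<noteq> 0" "degree (monom c k) = k"
      using \<open>c \<noteq> 0\<close> by (auto simp: degree_monom_eq)
    have dp: "degree p = degree h"
      unfolding p_def using degree_ot[OF assms m(1)] m(2) False by (simp add: k_def)
    have "coeff p (degree h) = lead_coeff g * (\<sigma> ^^ degree g) c"
      using ot_top[of g "monom c k"] m(2) False by (simp add: p_def k_def)
    then have "lead_coeff p = lead_coeff h"
      using assms dp by (simp add: c flip: mult.assoc)
    then have "h - p = 0 \<or> degree (h - p) < degree h"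
      using degree_diff_less_top[OF refl dp] by simp
    then have "\<exists>q r. h - p = g \<cdot> q + r \<and> (r = 0 \<or> degree r < degree g)"
      by (intro less.hyps) (use False in auto)
    then obtain q r where "h - p = g \<cdot> q + r" "r = 0 \<or> degree r < degree g"
      by blast
    then show ?thesis
      by (intro exI[of _ "q + monom c k"] exI[of _ r]) (auto simp: ot_add_right p_def algebra_simps)
  qed
qed

theorem lrem_ex1:
  assumes "g \<noteq> 0"
  shows "\<exists>!\<rho>. (\<rho> = 0 \<or> degree \<rho> < degree g) \<and>
              (\<exists>q \<in> carrier R. h = q \<otimes>\<^bsub>R\<^esub> g \<oplus>\<^bsub>R\<^esub> \<rho>)"
proof -
  have "r = r'" if "r = 0 \<or> degree r < degree g" "r' = 0 \<or> degree r' < degree g"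
    "q \<cdot> g + r = q' \<cdot> g + r'" for q q' r r'
  proof (rule ccontr)
    assume "r \<noteq> r'"
    have eq: "(q - q') \<cdot> g = r' - r"
      using that(3) by (simp add: ot_diff_left algebra_simps)
    then have "q - q' \<noteq> 0" using \<open>r \<noteq> r'\<close> by auto
    then have "degree g \<le> degree (r' - r)"
      using degree_ot[OF _ assms, of "q - q'"] eq by simp
    moreover have "degree (r' - r) < degree g"
      using that(1,2) \<open>r \<noteq> r'\<close> by (auto intro: degree_diff_less)
    ultimately show False by simp
  qed
  then show ?thesis
    using left_division[OF assms, of h] by (simp, metis)
qed


subsection \<open>Principal ideals\<close>

lemma PIdl_eq: "PIdl\<^bsub>R\<^esub> a = range (\<lambda>x. x \<cdot> a)"
  by (auto simp: cgenideal_def)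

lemma right_principal_eq: "right_principal R a = range (\<lambda>x. a \<cdot> x)"
  by (auto simp: right_principal_def)

lemma left_principal:
  assumes "0 \<in> I" "\<And>p q. p \<in> I \<Longrightarrow> q \<in> I \<Longrightarrow> p - q \<in> I" "\<And>p q. q \<in> I \<Longrightarrow> p \<cdot> q \<in> I"
  shows "\<exists>b. PIdl\<^bsub>R\<^esub> b = I"
proof (cases "I = {0}")
  case True
  then show ?thesis by (intro exI[of _ 0]) (auto simp: PIdl_eq)
next
  case False
  then obtain b where b: "b \<in> I" "b \<noteq> 0" "\<And>p. p \<in> I \<Longrightarrow> p \<noteq> 0 \<Longrightarrow> degree b \<le> degree p"
    using ex_has_least_nat[of "\<lambda>p. p \<in> I \<and> p \<noteq> 0" _ degree] assms(1) by blast
  have "p \<in> range (\<lambda>x. x \<cdot> b)" if "p \<in> I" for p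
  proof -
    obtain q r where qr: "p = q \<cdot> b + r" "r = 0 \<or> degree r < degree b"
      using left_division[OF b(2)] by blast
    then have "r = p - q \<cdot> b" by simp
    then have "r \<in> I" using assms(2,3) b(1) that by simp
    then have "r = 0" using b(3)[of r] qr(2) by (metis leD)
    then show ?thesis using qr by auto
  qed
  then show ?thesis using assms(3) b(1) by (intro exI[of _ b]) (auto simp: PIdl_eq)
qed

lemma right_principal:
  assumes "0 \<in> I" "\<And>p q. p \<in> I \<Longrightarrow> q \<in> I \<Longrightarrow> p - q \<in> I" "\<And>p q. p \<in> I \<Longrightarrow> p \<cdot> q \<in> I"
  shows "\<exists>b. right_principal R b = I"
proof (cases "I = {0}")
  case True
  then show ?thesis by (intro exI[of _ 0]) (auto simp: right_principal_eq)
next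
  case False
  then obtain b where b: "b \<in> I" "b \<noteq> 0" "\<And>p. p \<in> I \<Longrightarrow> p \<noteq> 0 \<Longrightarrow> degree b \<le> degree p"
    using ex_has_least_nat[of "\<lambda>p. p \<in> I \<and> p \<noteq> 0" _ degree] assms(1) by blast
  have "p \<in> range (\<lambda>x. b \<cdot> x)" if "p \<in> I" for p
  proof -
    obtain q r where qr: "p = b \<cdot> q + r" "r = 0 \<or> degree r < degree b"
      using right_division[OF b(2)] by blast
    then have "r = p - b \<cdot> q" by simp
    then have "r \<in> I" using assms(2,3) b(1) that by simp
    then have "r = 0" using b(3)[of r] qr(2) by (metis leD)
    then show ?thesis using qr by auto
  qed
  then show ?thesis using assms(3) b(1) by (intro exI[of _ b]) (auto simp: right_principal_eq)
qed

lemma PIdl_closed: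
  "0 \<in> PIdl\<^bsub>R\<^esub> a" "p \<in> PIdl\<^bsub>R\<^esub> a \<Longrightarrow> q \<in> PIdl\<^bsub>R\<^esub> a \<Longrightarrow> p - q \<in> PIdl\<^bsub>R\<^esub> a"
  "q \<in> PIdl\<^bsub>R\<^esub> a \<Longrightarrow> p \<cdot> q \<in> PIdl\<^bsub>R\<^esub> a" "a \<in> PIdl\<^bsub>R\<^esub> a"
  unfolding PIdl_eq
     apply (rule range_eqI[of _ _ 0], simp)
    apply (auto simp flip: ot_diff_left ot_assoc)[2]
  apply (rule range_eqI[of _ _ "[:1:]"], simp add: one_ot)
  done

theorem llcm_exists: "\<exists>m. is_llcm R m g h"
  unfolding is_llcm_def using left_principal[of "PIdl\<^bsub>R\<^esub> g \<inter> PIdl\<^bsub>R\<^esub> h"] PIdl_closed by simp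

theorem left_ann_principal: "\<exists>g \<in> carrier R. PIdl\<^bsub>R\<^esub> g = left_ann R d f"
proof -
  have "\<exists>g. PIdl\<^bsub>R\<^esub> g = left_ann R d f"
    by (rule left_principal) (auto simp: left_ann_def PIdl_closed ot_diff_left ot_assoc)
  then show ?thesis by simp
qed

lemma idealD:
  assumes "ideal I R"
  shows "0 \<in> I" "p \<in> I \<Longrightarrow> q \<in> I \<Longrightarrow> p - q \<in> I" "p \<in> I \<Longrightarrow> q \<cdot> p \<in> I" "p \<in> I \<Longrightarrow> p \<cdot> q \<in> I"
proof -
  interpret ideal I R by fact
  show 0: "0 \<in> I" using additive_subgroup.zero_closed[OF is_additive_subgroup] by simp
  show l: "p \<in> I \<Longrightarrow> q \<cdot> p \<in> I" for p q using I_l_closed[of p q] by simp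
  show "p \<in> I \<Longrightarrow> p \<cdot> q \<in> I" using I_r_closed[of p q] by simp
  assume "p \<in> I" "q \<in> I"
  then have "p + (- [:1:]) \<cdot> q \<in> I"
    using additive_subgroup.a_closed[OF is_additive_subgroup, of p "(- [:1:]) \<cdot> q"]
      l[of q "- [:1:]"] by simp
  then show "p - q \<in> I" by (simp add: ot_minus_left one_ot del: minus_pCons)
qed

lemma idealI':
  assumes "0 \<in> I" "\<And>p q. p \<in> I \<Longrightarrow> q \<in> I \<Longrightarrow> p - q \<in> I"
    "\<And>p q. p \<in> I \<Longrightarrow> q \<cdot> p \<in> I" "\<And>p q. p \<in> I \<Longrightarrow> p \<cdot> q \<in> I"
  shows "ideal I R"
proof (rule idealI)
  interpret ring R by (rule ring_ore_ring)
  have inv: "\<ominus>\<^bsub>R\<^esub> p = - p" for p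
    by (rule minus_equality) auto
  have m: "- p \<in> I" if "p \<in> I" for p
    using assms(2)[OF assms(1) that] by simp
  have "p + q \<in> I" if "p \<in> I" "q \<in> I" for p q
    using assms(2)[OF that(1) m[OF that(2)]] by simp
  then show "subgroup I (add_monoid R)"
    using assms(1) m by (intro add.subgroupI) (auto simp: inv simp flip: a_inv_def)
qed (auto simp: ring_ore_ring assms)

text \<open>Every twosided ideal has a twosided generator.\<close>

lemma twosided_generator:
  assumes "ideal I R"
  shows "\<exists>b. PIdl\<^bsub>R\<^esub> b = I \<and> twosided R b"
proof -
  note I = idealD[OF assms]
  obtain b where b: "PIdl\<^bsub>R\<^esub> b = I" using left_principal[of I] I by blast
  obtain c where c: "right_principal R c = I" using right_principal[of I] I by blast
  have "b \<in> I" using b PIdl_closed(4) by blast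
  have "c \<in> I" using c right_principal_eq[of c] ot_one[of c] by (metis rangeI)
  show ?thesis
  proof (cases "b = 0")
    case True
    then show ?thesis
      using b by (intro exI[of _ 0]) (auto simp: twosided_def right_principal_eq PIdl_eq)
  next
    case False
    obtain u where u: "b = c \<cdot> u" using c \<open>b \<in> I\<close> by (auto simp: right_principal_eq)
    obtain v where v: "c = v \<cdot> b" using b \<open>c \<in> I\<close> by (auto simp: PIdl_eq)
    have "b \<cdot> u \<in> I" using I(4) \<open>b \<in> I\<close> by blast
    then obtain w where w: "b \<cdot> u = w \<cdot> b" using b by (auto simp: PIdl_eq)
    have "(v \<cdot> w - [:1:]) \<cdot> b = 0"
      using u v w by (simp add: ot_diff_left one_ot) (metis ot_assoc)
    then have vw: "v \<cdot> w = [:1:]" using False by simp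
    then have "(w \<cdot> v - [:1:]) \<cdot> w = 0"
      by (simp add: ot_diff_left one_ot ot_assoc ot_one)
    moreover have "w \<noteq> 0" using vw by auto
    ultimately have wv: "w \<cdot> v = [:1:]" by simp
    have "PIdl\<^bsub>R\<^esub> c = I"
    proof
      show "PIdl\<^bsub>R\<^esub> c \<subseteq> I" using I(3) \<open>c \<in> I\<close> by (auto simp: PIdl_eq)
      have "x \<cdot> b = (x \<cdot> w) \<cdot> c" for x
        using wv by (metis v ot_assoc ot_one)
      then show "I \<subseteq> PIdl\<^bsub>R\<^esub> c" by (auto simp: PIdl_eq simp flip: b)
    qed
    then show ?thesis using c by (auto simp: twosided_def)
  qed
qed

theorem bound_exists: "\<exists>b. is_bound R b f"
proof -
  define A where "A = {p. \<forall>x. p \<cdot> x \<in> PIdl\<^bsub>R\<^esub> f}"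
  have A: "ideal A R"
    unfolding A_def by (rule idealI') (auto simp: PIdl_closed ot_diff_left ot_assoc)
  then obtain b where b: "PIdl\<^bsub>R\<^esub> b = A" "twosided R b"
    using twosided_generator by blast
  have "A \<subseteq> PIdl\<^bsub>R\<^esub> f"
    unfolding A_def by (metis (no_types, lifting) mem_Collect_eq ot_one subsetI)
  moreover have "J \<subseteq> A" if "ideal J R" "J \<subseteq> PIdl\<^bsub>R\<^esub> f" for J
    unfolding A_def using idealD(4)[OF that(1)] that(2) by blast
  ultimately have "is_bound R b f"
    unfolding is_bound_def using A b by simp
  then show ?thesis ..
qed

end

end

(* The elements x with f x in Rf form a subring containing the center, so Rf is a twosided ideal as
   soon as it is stable under right multiplication of f by the generators.  A twosided ideal inside
   Rf annihilates every element of R/Rf, so it already lies in the intersection of Rf with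
   Ann(d + Rf); hence replacing f by the least common multiple does not change the bound. *)

theory Submission
  imports Defs
begin

context ore_extension
begin

text \<open>Both directions rest on the unique existence of the remainder: a zero remainder leaves a
  quotient with \<open>h = q \<cdot> g\<close>, and for such \<open>h\<close> the candidate 0 must
  be the remainder.\<close>

lemma lrem_eq_0_iff:
  assumes "g \<noteq> 0"
  shows "lrem \<sigma> \<delta> h g = 0 \<longleftrightarrow> h \<in> PIdl\<^bsub>R\<^esub> g"
proof
  assume "lrem \<sigma> \<delta> h g = 0"
  then show "h \<in> PIdl\<^bsub>R\<^esub> g"
    using theI'[OF lrem_ex1[OF assms, of h]] by (auto simp: lrem_def PIdl_eq)
next
  assume "h \<in> PIdl\<^bsub>R\<^esub> g"
  then show "lrem \<sigma> \<delta> h g = 0"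
    unfolding lrem_def by (intro the1_equality lrem_ex1 assms) (auto simp: PIdl_eq)
qed

text \<open>Writing \<open>f \<cdot> x = q \<cdot> f\<close> moves \<open>f\<close> past
  \<open>x\<close>, and the left ideal absorbs \<open>q\<close>.\<close>

lemma mult_idealizer:
  assumes "f \<cdot> x \<in> PIdl\<^bsub>R\<^esub> f" "f \<cdot> y \<in> PIdl\<^bsub>R\<^esub> f"
  shows "f \<cdot> (x \<cdot> y) \<in> PIdl\<^bsub>R\<^esub> f"
proof -
  obtain q where "f \<cdot> x = q \<cdot> f"
    using assms(1) by (auto simp: PIdl_eq)
  then have "f \<cdot> (x \<cdot> y) = q \<cdot> (f \<cdot> y)"
    by (metis ot_assoc)
  with assms(2) show ?thesis
    by (simp add: PIdl_closed(3))
qed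

text \<open>This set is the idealizer of \<open>Rf\<close>, the largest subring in which
  \<open>Rf\<close> is a twosided ideal. Its closure properties carry a test on generators over to
  all they generate.\<close>

lemma subring_idealizer: "subring {x. f \<cdot> x \<in> PIdl\<^bsub>R\<^esub> f} R"
proof -
  interpret ring R by (rule ring_ore_ring)
  have inv: "\<ominus>\<^bsub>R\<^esub> x = - x" for x
    by (rule minus_equality) auto
  have neg: "- p \<in> PIdl\<^bsub>R\<^esub> f" if "p \<in> PIdl\<^bsub>R\<^esub> f" for p
    using PIdl_closed(2)[OF PIdl_closed(1) that] by simp
  have add: "p + q \<in> PIdl\<^bsub>R\<^esub> f" if "p \<in> PIdl\<^bsub>R\<^esub> f" "q \<in> PIdl\<^bsub>R\<^esub> f" for p q
    using PIdl_closed(2)[OF that(1) neg[OF that(2)]] by simp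
  show ?thesis
    by (rule subringI)
      (auto simp: inv ot_one ot_minus_right ot_add_right PIdl_closed(4) neg add mult_idealizer)
qed

text \<open>Since \<open>(p \<cdot> f) \<cdot> x = p \<cdot> (f \<cdot> x)\<close>, stability under
  right multiplication can be tested on the generator \<open>f\<close> alone.\<close>

lemma ideal_PIdl_iff: "ideal (PIdl\<^bsub>R\<^esub> f) R \<longleftrightarrow> (\<forall>x. f \<cdot> x \<in> PIdl\<^bsub>R\<^esub> f)"
proof
  assume "ideal (PIdl\<^bsub>R\<^esub> f) R"
  then show "\<forall>x. f \<cdot> x \<in> PIdl\<^bsub>R\<^esub> f"
    using idealD(4) PIdl_closed(4) by blast
next
  assume *: "\<forall>x. f \<cdot> x \<in> PIdl\<^bsub>R\<^esub> f"
  have "p \<cdot> x \<in> PIdl\<^bsub>R\<^esub> f" if "p \<in> PIdl\<^bsub>R\<^esub> f" for p x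
    using that * PIdl_closed(3) by (auto simp: PIdl_eq ot_assoc)
  then show "ideal (PIdl\<^bsub>R\<^esub> f) R"
    by (intro idealI') (auto simp: PIdl_closed)
qed

lemma ideal_PIdl_iff_generators:
  assumes "center_subalgebra R S = carrier R"
  shows "ideal (PIdl\<^bsub>R\<^esub> f) R \<longleftrightarrow> (\<forall>x\<in>S. f \<cdot> x \<in> PIdl\<^bsub>R\<^esub> f)"
proof
  assume *: "\<forall>x\<in>S. f \<cdot> x \<in> PIdl\<^bsub>R\<^esub> f"
  let ?I = "{x. f \<cdot> x \<in> PIdl\<^bsub>R\<^esub> f}"
  \<comment> \<open>For central \<open>z\<close>, \<open>f \<cdot> z = z \<cdot> f\<close> is a left
    multiple of \<open>f\<close>.\<close>
  have "ring_center R \<subseteq> ?I"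
    by (auto simp: ring_center_def PIdl_eq) (metis rangeI)
  then have "center_subalgebra R S \<subseteq> ?I"
    unfolding center_subalgebra_def using *
    by (intro ring.generate_ring_min_subring1[OF ring_ore_ring] subring_idealizer) auto
  with assms show "ideal (PIdl\<^bsub>R\<^esub> f) R"
    by (auto simp: ideal_PIdl_iff)
qed (simp add: ideal_PIdl_iff)

text \<open>If \<open>Rf\<close> is twosided, it is itself the largest twosided ideal inside
  \<open>Rf\<close>; conversely, a bound generates a twosided ideal.\<close>

lemma PIdl_eq_bound_iff:
  assumes "is_bound R b f"
  shows "PIdl\<^bsub>R\<^esub> f = PIdl\<^bsub>R\<^esub> b \<longleftrightarrow> ideal (PIdl\<^bsub>R\<^esub> f) R"
  using assms unfolding is_bound_def by auto

text \<open>Right absorption gives \<open>p \<cdot> x \<in> I\<close> for \<open>p \<in> I\<close>,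
  whatever \<open>x\<close> is.\<close>

lemma ideal_subset_left_ann:
  assumes "ideal I R" "I \<subseteq> PIdl\<^bsub>R\<^esub> f"
  shows "I \<subseteq> left_ann R x f"
  using assms idealD(4)[OF assms(1)] by (auto simp: left_ann_def)

end

text \<open>A bound generates the largest member of a family of twosided ideals; equal families have
  equal largest members.\<close>

lemma PIdl_bound_cong:
  assumes "is_bound R b f" "is_bound R c g"
    and "\<And>I. ideal I R \<Longrightarrow> I \<subseteq> PIdl\<^bsub>R\<^esub> f \<longleftrightarrow> I \<subseteq> PIdl\<^bsub>R\<^esub> g"
  shows "PIdl\<^bsub>R\<^esub> b = PIdl\<^bsub>R\<^esub> c"
  using assms unfolding is_bound_def by (meson subset_antisym)

theorem theorem2p5:
  fixes \<sigma> \<delta> :: "'a::division_ring \<Rightarrow> 'a"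
    and d :: "nat \<Rightarrow> 'a poly" and s :: nat and f :: "'a poly"
  defines "R \<equiv> ore_ring \<sigma> \<delta>"
  assumes "ring_automorphism \<sigma>" and "skew_derivation \<sigma> \<delta>"
    and "center_subalgebra R (d ` {1..s}) = carrier R"
    and "f \<noteq> \<zero>\<^bsub>R\<^esub>"
  shows
    "(\<forall>fb. is_bound R fb f \<longrightarrow>
        (PIdl\<^bsub>R\<^esub> f = PIdl\<^bsub>R\<^esub> fb \<longleftrightarrow> (\<forall>i\<in>{1..s}. lrem \<sigma> \<delta> (f \<otimes>\<^bsub>R\<^esub> d i) f = \<zero>\<^bsub>R\<^esub>))) \<and>
     (\<forall>i\<in>{1..s}. lrem \<sigma> \<delta> (f \<otimes>\<^bsub>R\<^esub> d i) f \<noteq> \<zero>\<^bsub>R\<^esub> \<longrightarrow>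
        (\<forall>fd\<in>carrier R. \<forall>m. PIdl\<^bsub>R\<^esub> fd = left_ann R (d i) f \<and> is_llcm R m fd f \<longrightarrow>
           (\<forall>fb mb. is_bound R fb f \<and> is_bound R mb m \<longrightarrow> PIdl\<^bsub>R\<^esub> fb = PIdl\<^bsub>R\<^esub> mb) \<and>
           PIdl\<^bsub>R\<^esub> m \<subset> PIdl\<^bsub>R\<^esub> f))"
proof (intro conjI allI ballI impI)
  interpret ore_extension \<sigma> \<delta>
    by (unfold_locales) fact+
  have f0: "f \<noteq> 0"
    using assms(5) by (simp add: R_def)
  have rem: "lrem \<sigma> \<delta> (f \<otimes>\<^bsub>R\<^esub> x) f = \<zero>\<^bsub>R\<^esub> \<longleftrightarrow> f \<cdot> x \<in> PIdl\<^bsub>R\<^esub> f" for x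
    using lrem_eq_0_iff[OF f0] by (simp add: R_def)
  {
    fix fb assume "is_bound R fb f"
    then show "PIdl\<^bsub>R\<^esub> f = PIdl\<^bsub>R\<^esub> fb \<longleftrightarrow>
        (\<forall>i\<in>{1..s}. lrem \<sigma> \<delta> (f \<otimes>\<^bsub>R\<^esub> d i) f = \<zero>\<^bsub>R\<^esub>)"
      unfolding rem using PIdl_eq_bound_iff ideal_PIdl_iff_generators assms(4)
      by (simp add: R_def)
  next
    fix i fd m
    assume nz: "lrem \<sigma> \<delta> (f \<otimes>\<^bsub>R\<^esub> d i) f \<noteq> \<zero>\<^bsub>R\<^esub>"
      and "PIdl\<^bsub>R\<^esub> fd = left_ann R (d i) f \<and> is_llcm R m fd f"
    then have m: "PIdl\<^bsub>R\<^esub> m = left_ann R (d i) f \<inter> PIdl\<^bsub>R\<^esub> f"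
      by (simp add: is_llcm_def)
    \<comment> \<open>The polynomial \<open>f\<close> itself witnesses strictness: the nonzero
      remainder says that \<open>f\<close> does not annihilate \<open>d i + Rf\<close>.\<close>
    have "f \<in> PIdl\<^bsub>R\<^esub> f" "f \<notin> left_ann R (d i) f"
      using nz PIdl_closed(4) by (simp_all add: rem left_ann_def R_def lrem_eq_0_iff[OF f0])
    with m show "PIdl\<^bsub>R\<^esub> m \<subset> PIdl\<^bsub>R\<^esub> f"
      by blast
    fix fb mb assume "is_bound R fb f \<and> is_bound R mb m"
    \<comment> \<open>A twosided ideal inside \<open>Rf\<close> lies in both factors of the
      intersection \<open>Rm\<close>; the converse holds because \<open>Rm\<close> is contained in
      \<open>Rf\<close>.\<close>
    moreover have "I \<subseteq> PIdl\<^bsub>R\<^esub> f \<longleftrightarrow> I \<subseteq> PIdl\<^bsub>R\<^esub> m" if "ideal I R" for I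
      using that ideal_subset_left_ann[of I f "d i"] unfolding R_def m[unfolded R_def] by blast
    ultimately show "PIdl\<^bsub>R\<^esub> fb = PIdl\<^bsub>R\<^esub> mb"
      by (intro PIdl_bound_cong[of R fb f mb m]) simp_all
  }
qed

end
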